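(* Let $\alpha\in\mathbb{R}$, let $m$ be a non-negative integer, and let $A$ be a Hermitian complex $q\times q$ matrix. Let $(s_j)_{j=0}^m$ and $(t_j)_{j=0}^m$ be sequences of Hermitian complex $q\times q$ matrices such that $t_m\le s_m$ and, in the case $m\ge1$, furthermore $t_j=s_j$ for all $j\in\{0,\dots,m-1\}$. Denote by $(s_j^{[-1,\alpha,A]})_{j=0}^{m+1}$ and $(t_j^{[-1,\alpha,A]})_{j=0}^{m+1}$ the inverse $\alpha$-S-transforms corresponding to $[(s_j)_{j=0}^m,A]$ and $[(t_j)_{j=0}^m,A]$, respectively. Then $t_j^{[-1,\alpha,A]}=s_j^{[-1,\alpha,A]}$ for each $j\in\{0,\dots,m\}$ and $t_{m+1}^{[-1,\alpha,A]}\le s_{m+1}^{[-1,\alpha,A]}$.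
   Context: $q$ is a positive integer; $A^\dagger$ is the Moore-Penrose inverse of a matrix $A$; for Hermitian matrices, $B\le C$ means that $C-B$ is non-negative Hermitian. Inverse $\alpha$-S-transform: for a sequence $(t_j)_{j=0}^m$ of complex $q\times q$ matrices and $A\in\mathbb{C}^{q\times q}$, the sequence $r_j=t_j^{[-1,\alpha,A]}$, $0\le j\le m+1$, is defined recursively by $r_0=A$ and, for $1\le j\le m+1$, $$r_j=\alpha^jA+\sum_{l=1}^j\alpha^{j-l}AA^\dagger\Bigl[\sum_{k=0}^{l-1}t_{l-k-1}A^\dagger\,(-\alpha r_{k-1}+r_k)\Bigr],$$ where $r_{-1}=0$. *)

theory Defs
  imports "HOL-Analysis.Analysis"
begin

definition conj_transpose :: "complex ^ 'n ^ 'm \<Rightarrow> complex ^ 'm ^ 'n" where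
  "conj_transpose M = (\<chi> i j. cnj (M $ j $ i))"

definition hermitian :: "complex ^ 'n ^ 'n \<Rightarrow> bool" where
  "hermitian M \<longleftrightarrow> conj_transpose M = M"

definition nonneg_hermitian :: "complex ^ 'n ^ 'n \<Rightarrow> bool" where
  "nonneg_hermitian M \<longleftrightarrow>
     hermitian M \<and> (\<forall>x. (\<Sum>i\<in>UNIV. cnj (x $ i) * (M *v x) $ i) \<in> \<real>\<^sub>\<ge>\<^sub>0)"

text \<open>
  The Loewner order on the set of Hermitian matrices. The library's order on vectors,
  and hence on matrices, is the componentwise one, so a separate relation is needed.
  Being an order on Hermitian matrices only, it includes that both arguments are Hermitian.
\<close>

definition loewner_le :: "complex ^ 'n ^ 'n \<Rightarrow> complex ^ 'n ^ 'n \<Rightarrow> bool"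
    (infix \<open>\<le>\<^sub>L\<close> 50) where
  "B \<le>\<^sub>L C \<longleftrightarrow> hermitian B \<and> hermitian C \<and> nonneg_hermitian (C - B)"

definition is_moore_penrose :: "complex ^ 'n ^ 'm \<Rightarrow> complex ^ 'm ^ 'n \<Rightarrow> bool" where
  "is_moore_penrose A X \<longleftrightarrow>
     A ** X ** A = A \<and> X ** A ** X = X \<and>
     hermitian (A ** X) \<and> hermitian (X ** A)"

definition moore_penrose :: "complex ^ 'n ^ 'm \<Rightarrow> complex ^ 'm ^ 'n"
    (\<open>(_\<^sup>\<dagger>)\<close> [1000] 1000) where
  "A\<^sup>\<dagger> = (THE X. is_moore_penrose A X)"

text \<open>
  A finite sequence \<open>t\<^sub>0, \<dots>, t\<^sub>m\<close> is represented by a function on \<^typ>\<open>nat\<close>;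
  the value at \<open>j\<close> only depends on \<open>t\<^sub>0, \<dots>, t\<^sub>j\<^sub>-\<^sub>1\<close>, so for \<open>j \<le> m + 1\<close> the
  entries of \<open>t\<close> beyond \<open>m\<close> are irrelevant.
  The conditional for \<open>k = 0\<close> encodes the convention that the value at \<open>- 1\<close> is zero.
\<close>

fun inv_S_transform ::
    "real \<Rightarrow> complex ^ 'q ^ 'q \<Rightarrow> (nat \<Rightarrow> complex ^ 'q ^ 'q) \<Rightarrow> nat \<Rightarrow> complex ^ 'q ^ 'q" where
  "inv_S_transform \<alpha> A t j =
    (if j = 0 then A
     else \<alpha> ^ j *\<^sub>R A +
       (\<Sum>l = 1..j. \<alpha> ^ (j - l) *\<^sub>R
         (A ** A\<^sup>\<dagger> **
           (\<Sum>k = 0..l - 1. t (l - k - 1) ** A\<^sup>\<dagger> **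
             ((- \<alpha>) *\<^sub>R (if k = 0 then 0 else inv_S_transform \<alpha> A t (k - 1))
               + inv_S_transform \<alpha> A t k)))))"

declare inv_S_transform.simps [simp del]

end

theory Submission
  imports Defs
begin

text \<open>
  Put \<open>u\<^sub>k = r\<^sub>k - \<alpha> r\<^sub>k\<^sub>-\<^sub>1\<close> and \<open>P = A A\<^sup>\<dagger>\<close>. The recursion telescopes to \<open>u\<^sub>0 = A\<close> and
  \<open>u\<^sub>l = P \<Sum>\<^sub>k\<^sub><\<^sub>l t\<^sub>l\<^sub>-\<^sub>k\<^sub>-\<^sub>1 A\<^sup>\<dagger> u\<^sub>k\<close>. Expanding this once more with the adjoint recursion for
  \<open>u\<^sub>k\<close> gives a sum that is visibly invariant under conjugate transposition, so all \<open>u\<^sub>l\<close>, and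
  hence all \<open>r\<^sub>j\<close>, are Hermitian. The entry \<open>t\<^sub>m\<close> enters \<open>r\<^sub>m\<^sub>+\<^sub>1\<close> only through the
  term \<open>k = 0\<close>, which is \<open>P t\<^sub>m A\<^sup>\<dagger> A = P t\<^sub>m P\<close>. The two values at \<open>m + 1\<close> therefore differ
  by the congruence transform \<open>P (s\<^sub>m - t\<^sub>m) P\<close>.
\<close>

section \<open>Hermitian matrices\<close>

lemma matrix_diff_ldistrib: "K ** (M - N) = K ** M - K ** N"
  for K :: "'a::ring_1 ^ 'n ^ 'm"
  by (simp add: matrix_matrix_mult_def vec_eq_iff sum_subtractf right_diff_distrib)

lemma matrix_diff_rdistrib: "(M - N) ** K = M ** K - N ** K"
  for K :: "'a::ring_1 ^ 'n ^ 'm"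
  by (simp add: matrix_matrix_mult_def vec_eq_iff sum_subtractf left_diff_distrib)

lemma matrix_mul_sum_right: "M ** sum f S = (\<Sum>x\<in>S. M ** f x)"
  for M :: "'a::comm_semiring_1 ^ 'n ^ 'm"
  by (induction S rule: infinite_finite_induct) (simp_all add: matrix_add_ldistrib)

lemma conj_transpose_mult: "conj_transpose (M ** N) = conj_transpose N ** conj_transpose M"
  by (simp add: conj_transpose_def matrix_matrix_mult_def vec_eq_iff mult.commute)

lemma conj_transpose_add: "conj_transpose (M + N) = conj_transpose M + conj_transpose N"
  by (simp add: conj_transpose_def vec_eq_iff)

lemma conj_transpose_scaleR: "conj_transpose (c *\<^sub>R M) = c *\<^sub>R conj_transpose M"
  by (simp add: conj_transpose_def vec_eq_iff)

lemma conj_transpose_sum: "conj_transpose (sum f S) = (\<Sum>x\<in>S. conj_transpose (f x))"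
  by (simp add: conj_transpose_def vec_eq_iff)

lemma conj_transpose_conj_transpose: "conj_transpose (conj_transpose M) = M"
  by (simp add: conj_transpose_def vec_eq_iff)

lemma hermitianD: "hermitian M \<Longrightarrow> conj_transpose M = M"
  by (simp add: hermitian_def)

lemma conj_transpose_adjoint:
  "(\<Sum>i\<in>UNIV. cnj (x $ i) * (M *v y) $ i) =
   (\<Sum>i\<in>UNIV. cnj ((conj_transpose M *v x) $ i) * y $ i)"
proof -
  have "(\<Sum>i\<in>UNIV. cnj (x $ i) * (M *v y) $ i) = (\<Sum>i\<in>UNIV. \<Sum>j\<in>UNIV. cnj (x $ i) * M $ i $ j * y $ j)"
    by (simp add: matrix_vector_mult_def sum_distrib_left mult.assoc)
  also have "\<dots> = (\<Sum>j\<in>UNIV. \<Sum>i\<in>UNIV. cnj (x $ i) * M $ i $ j * y $ j)"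
    by (rule sum.swap)
  also have "\<dots> = (\<Sum>i\<in>UNIV. cnj ((conj_transpose M *v x) $ i) * y $ i)"
    by (simp add: matrix_vector_mult_def conj_transpose_def sum_distrib_right)
      (simp add: mult_ac)
  finally show ?thesis .
qed

lemma nonneg_hermitian_congruence:
  assumes "nonneg_hermitian M"
  shows "nonneg_hermitian (conj_transpose N ** M ** N)"
  unfolding nonneg_hermitian_def
proof (intro conjI allI)
  show "hermitian (conj_transpose N ** M ** N)"
    using assms by (simp add: nonneg_hermitian_def hermitian_def conj_transpose_mult
        conj_transpose_conj_transpose matrix_mul_assoc)
  fix x
  have "(\<Sum>i\<in>UNIV. cnj (x $ i) * (conj_transpose N ** M ** N *v x) $ i) =
      (\<Sum>i\<in>UNIV. cnj (x $ i) * (conj_transpose N *v (M *v (N *v x))) $ i)"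
    by (simp add: matrix_vector_mul_assoc matrix_mul_assoc)
  also have "\<dots> = (\<Sum>i\<in>UNIV. cnj ((N *v x) $ i) * (M *v (N *v x)) $ i)"
    by (simp add: conj_transpose_adjoint conj_transpose_conj_transpose)
  also have "\<dots> \<in> \<real>\<^sub>\<ge>\<^sub>0"
    using assms by (simp add: nonneg_hermitian_def)
  finally show "(\<Sum>i\<in>UNIV. cnj (x $ i) * (conj_transpose N ** M ** N *v x) $ i) \<in> \<real>\<^sub>\<ge>\<^sub>0" .
qed

section \<open>The Moore-Penrose inverse of a Hermitian matrix\<close>

text \<open>\<open>A ** X = (A ** Y) ** (A ** X)\<close> has Hermitian factors, so taking adjoints
  reverses their order and leaves \<open>A ** Y\<close>. Likewise \<open>X ** A = Y ** A\<close>,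
  and both combine to \<open>X = X ** A ** X = Y ** A ** Y = Y\<close>.\<close>

lemma is_moore_penrose_unique:
  assumes "is_moore_penrose A X" "is_moore_penrose A Y"
  shows "X = Y"
proof -
  note X = assms(1)[unfolded is_moore_penrose_def]
  note Y = assms(2)[unfolded is_moore_penrose_def]
  have "A ** X = conj_transpose ((A ** Y ** A) ** X)"
    using X Y by (simp add: hermitian_def)
  also have "\<dots> = conj_transpose ((A ** Y) ** (A ** X))"
    by (simp add: matrix_mul_assoc)
  also have "\<dots> = (A ** X) ** (A ** Y)"
    using X Y by (simp only: conj_transpose_mult[of "A ** Y" "A ** X"] hermitianD)
  also have "\<dots> = A ** Y"
    using X by (simp add: matrix_mul_assoc)
  finally have AX: "A ** X = A ** Y" .
  have "X ** A = conj_transpose (X ** (A ** Y ** A))"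
    using X Y by (simp add: hermitian_def)
  also have "\<dots> = conj_transpose ((X ** A) ** (Y ** A))"
    by (simp add: matrix_mul_assoc)
  also have "\<dots> = (Y ** A) ** (X ** A)"
    using X Y by (simp only: conj_transpose_mult[of "X ** A" "Y ** A"] hermitianD)
  also have "\<dots> = Y ** (A ** X ** A)"
    by (simp add: matrix_mul_assoc)
  also have "\<dots> = Y ** A"
    using X by simp
  finally have XA: "X ** A = Y ** A" .
  have "X = X ** A ** X"
    using X by simp
  also have "\<dots> = Y ** A ** Y"
    by (metis AX XA matrix_mul_assoc)
  also have "\<dots> = Y"
    using Y by simp
  finally show ?thesis .
qed

lemma moore_penrose_eqI: "is_moore_penrose A X \<Longrightarrow> A\<^sup>\<dagger> = X"
  unfolding moore_penrose_def by (blast intro: is_moore_penrose_unique)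

text \<open>Moving one factor \<open>A\<close> across the inner product turns the squared norm of
  \<open>A *v x\<close> into the product of \<open>A *v (A *v x) = 0\<close> with
  \<open>x\<close>.\<close>

lemma hermitian_square_eq_0:
  assumes "hermitian A" "A *v (A *v x) = 0"
  shows "A *v x = 0"
proof -
  have "(\<Sum>i\<in>UNIV. cnj ((A *v x) $ i) * (A *v x) $ i) =
      (\<Sum>i\<in>UNIV. cnj ((A *v (A *v x)) $ i) * x $ i)"
    using assms(1) by (simp add: conj_transpose_adjoint hermitian_def)
  also have "\<dots> = 0"
    by (simp add: assms(2))
  finally have "complex_of_real (\<Sum>i\<in>UNIV. (cmod ((A *v x) $ i))\<^sup>2) = 0"
    by (simp only: complex_norm_square of_real_sum mult.commute)
  then have "(\<Sum>i\<in>UNIV. (cmod ((A *v x) $ i))\<^sup>2) = 0"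
    by (simp only: of_real_eq_0_iff)
  then show ?thesis
    by (simp add: sum_nonneg_eq_0_iff vec_eq_iff)
qed

text \<open>\<open>A\<close> is injective on its range, hence maps its range onto itself.\<close>

lemma hermitian_eq_square_mult:
  assumes "hermitian A"
  obtains B where "A = A ** A ** B"
proof -
  let ?f = "\<lambda>x. A *v x"
  have lin: "linear ?f"
    by simp
  have sub: "subspace (range ?f)"
    by (rule linear_subspace_image[OF lin subspace_UNIV])
  have "inj_on ?f (range ?f)"
  proof (rule inj_onI, clarify)
    fix x y assume "A *v (A *v x) = A *v (A *v y)"
    then have "A *v (A *v (x - y)) = 0"
      by (simp add: matrix_vector_mult_diff_distrib)
    from hermitian_square_eq_0[OF assms this] show "A *v x = A *v y"
      by (simp add: matrix_vector_mult_diff_distrib)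
  qed
  \<comment> \<open>Dimensions are taken over the reals. A subspace of the range with the same
    dimension is the whole range.\<close>
  then have "dim (?f ` range ?f) = dim (range ?f)"
    by (intro dim_image_eq lin) (simp add: sub span_eq_iff[THEN iffD2])
  then have range_eq: "?f ` range ?f = range ?f"
    by (intro subspace_dim_equal sub linear_subspace_image lin) auto
  \<comment> \<open>The left-hand side is column \<open>j\<close> of \<open>A\<close>; the chosen
    preimages become the columns of \<open>B\<close>.\<close>
  have "\<exists>y. A *v axis j 1 = A *v (A *v y)" for j
    using range_eq by blast
  then obtain b where b: "A *v axis j 1 = A *v (A *v b j)" for j
    by metis
  have col: "(M ** (\<chi> i j. b j $ i)) $ i $ j = (M *v b j) $ i" for M :: "complex ^ 'a ^ 'a" and i j
    by (simp add: matrix_matrix_mult_def matrix_vector_mult_def)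
  have "A = A ** A ** (\<chi> i j. b j $ i)"
    unfolding vec_eq_iff col
    by (simp flip: matrix_vector_mul_assoc b) (simp add: matrix_vector_mult_def axis_def if_distrib cong: if_cong)
  then show thesis
    by (rule that)
qed

text \<open>
  If \<open>A = A\<^sup>2 B\<close>, then \<open>Q = A B\<close> satisfies \<open>Q = Q\<^sup>* Q\<close>, so it is the orthogonal projection
  onto the range of \<open>A\<close>.
\<close>

lemma moore_penrose_hermitian:
  assumes "hermitian A"
  shows "is_moore_penrose A A\<^sup>\<dagger>" "hermitian A\<^sup>\<dagger>" "A\<^sup>\<dagger> ** A = A ** A\<^sup>\<dagger>"
proof -
  obtain B where B: "A = A ** A ** B"
    using hermitian_eq_square_mult[OF assms] .
  define C where "C = conj_transpose B"
  define Q where "Q = A ** B"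
  note herm = hermitianD[OF assms]
  have AQ: "A ** Q = A"
    using B by (simp add: Q_def matrix_mul_assoc)
  have Qct: "conj_transpose Q = C ** A"
    by (simp add: Q_def C_def conj_transpose_mult herm)
  have "conj_transpose (A ** Q) = A"
    by (simp add: AQ herm)
  then have QA': "conj_transpose Q ** A = A"
    by (simp add: conj_transpose_mult herm)
  then have QQ': "conj_transpose Q ** Q = Q"
    by (simp add: Q_def matrix_mul_assoc)
  then have Q: "conj_transpose Q = Q"
    by (metis conj_transpose_mult conj_transpose_conj_transpose)
  have QA: "Q ** A = A" and QQ: "Q ** Q = Q" and CA: "C ** A = Q"
    using QA' QQ' Qct Q by simp_all
  \<comment> \<open>This symmetric form makes \<open>X\<close> Hermitian, and
    \<open>C ** A = Q\<close> reduces it to \<open>Q ** B\<close>.\<close>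
  define X where "X = C ** A ** B"
  have XQ: "X = Q ** B"
    by (simp add: X_def CA)
  have AX: "A ** X = Q"
    by (simp add: XQ matrix_mul_assoc AQ) (simp add: Q_def)
  have XA: "X ** A = Q"
  proof -
    have "X ** A = C ** (Q ** A)"
      by (simp add: X_def Q_def matrix_mul_assoc)
    then show ?thesis
      by (simp add: QA CA)
  qed
  have "is_moore_penrose A X"
    by (simp add: is_moore_penrose_def hermitian_def AX XA Q QA)
      (simp add: XQ matrix_mul_assoc QQ)
  moreover have "hermitian X"
    by (simp add: X_def C_def hermitian_def conj_transpose_mult conj_transpose_conj_transpose
        herm matrix_mul_assoc)
  ultimately show "is_moore_penrose A A\<^sup>\<dagger>" "hermitian A\<^sup>\<dagger>" "A\<^sup>\<dagger> ** A = A ** A\<^sup>\<dagger>"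
    using moore_penrose_eqI[of A X] by (simp_all add: AX XA)
qed

section \<open>Increments of the transform\<close>

text \<open>This is the bracket of the recursion, kept in the same syntactic form so that the
  recursion folds into it.\<close>

definition inv_S_increment ::
    "real \<Rightarrow> complex ^ 'q ^ 'q \<Rightarrow> (nat \<Rightarrow> complex ^ 'q ^ 'q) \<Rightarrow> nat \<Rightarrow> complex ^ 'q ^ 'q" where
  "inv_S_increment \<alpha> A t k =
    (- \<alpha>) *\<^sub>R (if k = 0 then 0 else inv_S_transform \<alpha> A t (k - 1)) + inv_S_transform \<alpha> A t k"

lemma inv_S_transform_0: "inv_S_transform \<alpha> A t 0 = A"
  by (simp add: inv_S_transform.simps)

lemma inv_S_increment_0: "inv_S_increment \<alpha> A t 0 = A"
  by (simp add: inv_S_increment_def inv_S_transform_0)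

lemma inv_S_transform_Suc_increment:
  "inv_S_transform \<alpha> A t (Suc j) = \<alpha> *\<^sub>R inv_S_transform \<alpha> A t j + inv_S_increment \<alpha> A t (Suc j)"
  by (simp add: inv_S_increment_def)

text \<open>Subtracting \<alpha> times the previous value cancels the leading term and all summands
  with \<open>l \<le> j\<close>; only \<open>l = Suc j\<close> survives.\<close>

lemma inv_S_increment_Suc:
  "inv_S_increment \<alpha> A t (Suc j) =
    A ** A\<^sup>\<dagger> ** (\<Sum>k\<le>j. t (j - k) ** A\<^sup>\<dagger> ** inv_S_increment \<alpha> A t k)"
proof -
  define w where
    "w l = A ** A\<^sup>\<dagger> ** (\<Sum>k=0..l-1. t (l - k - 1) ** A\<^sup>\<dagger> ** inv_S_increment \<alpha> A t k)" for l
  have r: "inv_S_transform \<alpha> A t j = \<alpha> ^ j *\<^sub>R A + (\<Sum>l=1..j. \<alpha> ^ (j - l) *\<^sub>R w l)" for j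
    by (subst inv_S_transform.simps) (simp add: w_def inv_S_increment_def)
  have "(\<Sum>l=1..j. \<alpha> ^ (Suc j - l) *\<^sub>R w l) = \<alpha> *\<^sub>R (\<Sum>l=1..j. \<alpha> ^ (j - l) *\<^sub>R w l)"
    by (simp add: scaleR_sum_right Suc_diff_le)
  then have "inv_S_increment \<alpha> A t (Suc j) = w (Suc j)"
    by (simp add: inv_S_increment_def r[of j] r[of "Suc j"] scaleR_add_right)
  then show ?thesis
    by (simp add: w_def atMost_atLeast0)
qed

lemma inv_S_transform_cong:
  "(\<And>i. i < j \<Longrightarrow> t i = s i) \<Longrightarrow> inv_S_transform \<alpha> A t j = inv_S_transform \<alpha> A s j"
proof (induction j rule: less_induct)
  case (less j)
  show ?case
  proof (cases j)
    case 0
    then show ?thesis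
      by (simp add: inv_S_transform_0)
  next
    case (Suc n)
    have r: "inv_S_transform \<alpha> A t k = inv_S_transform \<alpha> A s k" if "k \<le> n" for k
      using that Suc less by simp
    \<comment> \<open>The next increment involves all earlier ones, hence the strong
      induction.\<close>
    then have "inv_S_increment \<alpha> A t k = inv_S_increment \<alpha> A s k" if "k \<le> n" for k
      using that by (simp add: inv_S_increment_def)
    then have "inv_S_increment \<alpha> A t (Suc n) = inv_S_increment \<alpha> A s (Suc n)"
      using less.prems Suc by (simp add: inv_S_increment_Suc)
    then show ?thesis
      using r by (simp add: Suc inv_S_transform_Suc_increment)
  qed
qed

section \<open>Hermitian values of the transform\<close>

text \<open>The double expansion has summands \<open>F a i b\<close> with
  \<open>a + i + b = l - 2\<close>. The adjoint swaps \<open>a\<close> and \<open>b\<close>, which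
  only permutes the summands.\<close>

lemma inv_S_increment_hermitian:
  assumes A: "hermitian A"
  shows "(\<And>i. i < l \<Longrightarrow> hermitian (t i)) \<Longrightarrow> hermitian (inv_S_increment \<alpha> A t l)"
proof (induction l rule: less_induct)
  case (less l)
  define P where "P = A ** A\<^sup>\<dagger>"
  define u where "u = inv_S_increment \<alpha> A t"
  note mp = moore_penrose_hermitian[OF A]
  have P: "conj_transpose P = P"
    using mp(1) by (simp add: P_def is_moore_penrose_def hermitian_def)
  note Y = hermitianD[OF mp(2)]
  have t: "conj_transpose (t i) = t i" if "i < l" for i
    using less.prems that by (simp add: hermitian_def)
  have u: "conj_transpose (u k) = u k" if "k < l" for k
    using less that by (simp add: u_def hermitian_def)
  have u_Suc: "u (Suc j) = (\<Sum>k\<le>j. P ** t (j - k) ** A\<^sup>\<dagger> ** u k)" for j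
    by (simp add: u_def P_def inv_S_increment_Suc matrix_mul_sum_right matrix_mul_assoc)
  \<comment> \<open>The mirrored recursion needs \<open>u (Suc j)\<close> to be Hermitian already,
    which the induction hypothesis gives for \<open>Suc j < l\<close>.\<close>
  have u_Suc': "u (Suc j) = (\<Sum>k\<le>j. u k ** A\<^sup>\<dagger> ** t (j - k) ** P)" if "Suc j < l" for j
  proof -
    have "u (Suc j) = conj_transpose (u (Suc j))"
      using u that by simp
    also have "\<dots> = (\<Sum>k\<le>j. u k ** A\<^sup>\<dagger> ** t (j - k) ** P)"
      unfolding u_Suc conj_transpose_sum
      using that by (intro sum.cong) (simp_all add: conj_transpose_mult P Y t u matrix_mul_assoc)
    finally show ?thesis .
  qed
  show ?case
  proof (cases l)
    case 0
    then show ?thesis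
      using A by (simp add: inv_S_increment_0)
  next
    case (Suc n)
    define F where "F a i b = P ** t a ** A\<^sup>\<dagger> ** u i ** A\<^sup>\<dagger> ** t b ** P" for a i b
    let ?I = "SIGMA j:{..<n}. {..j}"
    \<comment> \<open>The term \<open>k = 0\<close> ends in \<open>A\<^sup>\<dagger> ** A\<close>,
      which equals \<open>P\<close> because \<open>A\<close> is Hermitian.\<close>
    have "P ** t n ** A\<^sup>\<dagger> ** u 0 = P ** t n ** P"
      by (simp add: u_def inv_S_increment_0 P_def flip: matrix_mul_assoc mp(3))
    then have "u l = P ** t n ** P + (\<Sum>j<n. P ** t (n - Suc j) ** A\<^sup>\<dagger> ** u (Suc j))"
      unfolding Suc u_Suc[of n] sum.atMost_shift by simp
    also have "(\<Sum>j<n. P ** t (n - Suc j) ** A\<^sup>\<dagger> ** u (Suc j)) =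
        (\<Sum>j<n. \<Sum>i\<le>j. F (n - Suc j) i (j - i))"
      using Suc by (intro sum.cong)
        (simp_all add: u_Suc' F_def matrix_mul_sum_right matrix_mul_assoc)
    also have "\<dots> = (\<Sum>(j, i)\<in>?I. F (n - Suc j) i (j - i))"
      by (simp add: sum.Sigma)
    finally have ul: "u l = P ** t n ** P + (\<Sum>(j, i)\<in>?I. F (n - Suc j) i (j - i))" .
    have F: "conj_transpose (F a i b) = F b i a" if "a < l" "b < l" "i < l" for a i b
      using that by (simp add: F_def conj_transpose_mult P Y t u matrix_mul_assoc)
    have "conj_transpose (\<Sum>(j, i)\<in>?I. F (n - Suc j) i (j - i)) =
        (\<Sum>(j, i)\<in>?I. F (j - i) i (n - Suc j))"
      unfolding conj_transpose_sum using Suc by (intro sum.cong) (auto simp: F)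
    also have "\<dots> = (\<Sum>(j, i)\<in>?I. F (n - Suc j) i (j - i))"
      \<comment> \<open>Swapping \<open>a = n - Suc j\<close> and \<open>b = j - i\<close> with
        \<open>i\<close> fixed sends \<open>j\<close> to \<open>n + i - Suc j\<close>, an involution
        of the index set.\<close>
      by (rule sum.reindex_bij_witness[of _ "\<lambda>(j, i). (n + i - Suc j, i)" "\<lambda>(j, i). (n + i - Suc j, i)"])
        (auto intro!: arg_cong2[where f = "\<lambda>a b. F a _ b"])
    finally have "conj_transpose (u l) = u l"
      unfolding ul conj_transpose_add
      using Suc by (simp add: conj_transpose_mult P t matrix_mul_assoc)
    then show ?thesis
      by (simp add: u_def hermitian_def)
  qed
qed

lemma inv_S_transform_hermitian:
  assumes A: "hermitian A"
  shows "(\<And>i. i < j \<Longrightarrow> hermitian (t i)) \<Longrightarrow> hermitian (inv_S_transform \<alpha> A t j)"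
proof (induction j)
  case 0
  then show ?case
    using A by (simp add: inv_S_transform_0)
next
  case (Suc j)
  have "hermitian (inv_S_increment \<alpha> A t (Suc j))"
    using A Suc.prems by (rule inv_S_increment_hermitian)
  then show ?case
    using Suc by (simp add: inv_S_transform_Suc_increment hermitian_def conj_transpose_add
        conj_transpose_scaleR)
qed

section \<open>Dependence on the last entry\<close>

lemma inv_S_transform_Suc_diff:
  assumes "\<And>j. j < m \<Longrightarrow> t j = s j"
  shows "inv_S_transform \<alpha> A s (Suc m) - inv_S_transform \<alpha> A t (Suc m) =
    A ** A\<^sup>\<dagger> ** (s m - t m) ** (A\<^sup>\<dagger> ** A)"
proof -
  have r: "inv_S_transform \<alpha> A t j = inv_S_transform \<alpha> A s j" if "j \<le> m" for j
    using that assms by (intro inv_S_transform_cong) simp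
  then have u: "inv_S_increment \<alpha> A t j = inv_S_increment \<alpha> A s j" if "j \<le> m" for j
    using that by (simp add: inv_S_increment_def)
  \<comment> \<open>Splitting off \<open>k = 0\<close> isolates \<open>x m\<close>; the other
    summands use only \<open>x 0\<close> to \<open>x (m - 1)\<close>.\<close>
  have split: "inv_S_transform \<alpha> A x (Suc m) = \<alpha> *\<^sub>R inv_S_transform \<alpha> A x m +
      A ** A\<^sup>\<dagger> ** (x m ** A\<^sup>\<dagger> ** A +
        (\<Sum>i<m. x (m - Suc i) ** A\<^sup>\<dagger> ** inv_S_increment \<alpha> A x (Suc i)))" for x
    unfolding inv_S_transform_Suc_increment inv_S_increment_Suc[of _ _ _ m] sum.atMost_shift
    by (simp add: inv_S_increment_0)
  have "(\<Sum>i<m. t (m - Suc i) ** A\<^sup>\<dagger> ** inv_S_increment \<alpha> A t (Suc i)) =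
      (\<Sum>i<m. s (m - Suc i) ** A\<^sup>\<dagger> ** inv_S_increment \<alpha> A s (Suc i))"
    using assms u by (intro sum.cong) simp_all
  then show ?thesis
    by (simp add: split r matrix_add_ldistrib matrix_diff_ldistrib matrix_diff_rdistrib
        matrix_mul_assoc)
qed

theorem lemma3p13:
  fixes \<alpha> :: real and m :: nat
    and A :: "complex ^ 'q ^ 'q"
    and s t :: "nat \<Rightarrow> complex ^ 'q ^ 'q"
  assumes "hermitian A"
    and "\<And>j. j \<le> m \<Longrightarrow> hermitian (s j)"
    and "\<And>j. j \<le> m \<Longrightarrow> hermitian (t j)"
    and "t m \<le>\<^sub>L s m"
    and "\<And>j. j < m \<Longrightarrow> t j = s j"
  shows "(\<forall>j\<le>m. inv_S_transform \<alpha> A t j = inv_S_transform \<alpha> A s j) \<and>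
         inv_S_transform \<alpha> A t (m + 1) \<le>\<^sub>L inv_S_transform \<alpha> A s (m + 1)"
proof
  show "\<forall>j\<le>m. inv_S_transform \<alpha> A t j = inv_S_transform \<alpha> A s j"
    using assms(5) by (auto intro: inv_S_transform_cong)
  note mp = moore_penrose_hermitian[OF assms(1)]
  have "conj_transpose (A ** A\<^sup>\<dagger>) = A ** A\<^sup>\<dagger>"
    using mp(1) by (simp add: is_moore_penrose_def hermitian_def)
  then have "nonneg_hermitian (A ** A\<^sup>\<dagger> ** (s m - t m) ** (A ** A\<^sup>\<dagger>))"
    using nonneg_hermitian_congruence[of "s m - t m" "A ** A\<^sup>\<dagger>"] assms(4)
    by (simp add: loewner_le_def)
  \<comment> \<open>Since \<open>A\<^sup>\<dagger> ** A = A ** A\<^sup>\<dagger>\<close>, the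
    difference is a congruence by a Hermitian matrix.\<close>
  then show "inv_S_transform \<alpha> A t (m + 1) \<le>\<^sub>L inv_S_transform \<alpha> A s (m + 1)"
    using assms by (simp add: loewner_le_def inv_S_transform_Suc_diff mp(3)
        inv_S_transform_hermitian)
qed

end
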